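(* Let a (nondegenerate) tetrahedron with vertices $x,y,z,w$ be given, placed so that the basic triangle $x,y,z$ lies in the horizontal plane, $x=(x_1,x_2,0)$, $y=(y_1,y_2,0)$, $z=(z_1,z_2,0)$, oriented counterclockwise, and $w=(w_1,w_2,w_3)$ with $w_3>0$. Let $r$ be its inradius, $R$ its circumradius, $d$ the distance between its incenter and its circumcenter, and let $c=(c_1,c_2,0)$ be the point at which the insphere touches the basic triangle. Let $a_0, A, B, u_1, u_2, v_1, v_2$ be the quantities defined in the context; they are polynomials in the coordinates of $x,y,z,c$ only (they depend only on the basic face with its tangent point $c$, not on $w$ or $r$). Then $a_0>0$, $A>0$, $B>0$, and $$\big(R^2-d^2-3r^2\big)^2-(2rR)^2 \;=\; r^2\,\frac{(u_1r^2+v_1)^2+(u_2r^2+v_2)^2}{a_0\,(A-B\,r^2)} .$$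
   Context: Norms $\|\cdot\|$ are Euclidean. The quantities are: $a_0 = x_1y_2+y_1z_2+z_1x_2-y_1x_2-z_1y_2-x_1z_2$ (twice the area of triangle $xyz$), $a_x = c_1y_2+y_1z_2+z_1c_2-y_1c_2-z_1y_2-c_1z_2$ (twice the area of $cyz$), $a_y = x_1c_2+c_1z_2+z_1x_2-c_1x_2-z_1c_2-x_1z_2$ (twice the area of $xcz$), $a_z = x_1y_2+y_1c_2+c_1x_2-y_1x_2-c_1y_2-x_1c_2$ (twice the area of $xyc$). $A=a_xa_ya_z$, and $B=\|x\|^2a_x+\|y\|^2a_y+\|z\|^2a_z-\|c\|^2a_0$. $o_1,o_2$ are the coordinates of the circumcenter of the basic triangle in its plane (equivalently the first two coordinates of the circumcenter of the tetrahedron): $2a_0o_1=\|x\|^2(y_2-z_2)+\|y\|^2(z_2-x_2)+\|z\|^2(x_2-y_2)$, $2a_0o_2=\|x\|^2(z_1-y_1)+\|y\|^2(x_1-z_1)+\|z\|^2(y_1-x_1)$. $u_1=4a_0(c_1-o_1)$, $u_2=4a_0(c_2-o_2)$. $$\begin{aligned} v_1={}& c_1(c_1^2+c_2^2)a_0-2c_1^2a_0o_1\\ &+ y_1z_1(y_2-z_2)(c_1^2-x_1^2-(c_2-x_2)^2)\\ &+ z_1x_1(z_2-x_2)(c_1^2-y_1^2-(c_2-y_2)^2)\\ &+ x_1y_1(x_2-y_2)(c_1^2-z_1^2-(c_2-z_2)^2)\\ &+ c_1^2\big(x_2^2(z_2-y_2)+y_2^2(x_2-z_2)+z_2^2(y_2-x_2)\big)\\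 &+ c_2^2\big(x_1^2(z_2-y_2)+y_1^2(x_2-z_2)+z_1^2(y_2-x_2)\big)\\ &+ x_1^2(y_2-z_2)\big(c_1(y_1+z_1)+c_2(y_2+z_2)-y_2z_2\big)\\ &+ y_1^2(z_2-x_2)\big(c_1(z_1+x_1)+c_2(z_2+x_2)-z_2x_2\big)\\ &+ z_1^2(x_2-y_2)\big(c_1(x_1+y_1)+c_2(x_2+y_2)-x_2y_2\big)\\ &+ 2c_1c_2\big(x_1x_2(y_2-z_2)+y_1y_2(z_2-x_2)+z_1z_2(x_2-y_2)\big)\\ &+ 2c_1c_2\big(x_1(z_2^2-y_2^2)+y_1(x_2^2-z_2^2)+z_1(y_2^2-x_2^2)\big)\\ &+ c_1\big(x_1x_2(z_2^2-y_2^2)+y_1y_2(x_2^2-z_2^2)+z_1z_2(y_2^2-x_2^2)\big)\\ &+ 3c_1\big(x_1y_2z_2(y_2-z_2)+x_2y_1z_2(z_2-x_2)+x_2y_2z_1(x_2-y_2)\big), \end{aligned}$$ $$\begin{aligned} v_2={}& c_2(c_1^2+c_2^2)a_0-2c_2^2a_0o_2\\ &+ y_2z_2(y_1-z_1)((c_1-x_1)^2-c_2^2+x_2^2)\\ &+ x_2z_2(z_1-x_1)((c_1-y_1)^2-c_2^2+y_2^2)\\ &+ x_2y_2(x_1-y_1)((c_1-z_1)^2-c_2^2+z_2^2)\\ &+ c_1^2\big(x_2^2(y_1-z_1)+y_2^2(z_1-x_1)+z_2^2(x_1-y_1)\big)\\ &+ c_2^2\big(x_1^2(y_1-z_1)+y_1^2(z_1-x_1)+z_1^2(x_1-y_1)\big)\\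 &+ x_2^2(z_1-y_1)\big(c_1(y_1+z_1)+c_2(y_2+z_2)-y_1z_1\big)\\ &+ y_2^2(x_1-z_1)\big(c_1(z_1+x_1)+c_2(z_2+x_2)-z_1x_1\big)\\ &+ z_2^2(y_1-x_1)\big(c_1(x_1+y_1)+c_2(x_2+y_2)-x_1y_1\big)\\ &+ 2c_1c_2\big(x_1x_2(z_1-y_1)+y_1y_2(x_1-z_1)+z_1z_2(y_1-x_1)\big)\\ &+ 2c_1c_2\big(x_2(y_1^2-z_1^2)+y_2(z_1^2-x_1^2)+z_2(x_1^2-y_1^2)\big)\\ &+ c_2\big(x_1x_2(y_1^2-z_1^2)+y_1y_2(z_1^2-x_1^2)+z_1z_2(x_1^2-y_1^2)\big)\\ &+ 3c_2\big(x_1^2(y_2z_1-y_1z_2)+y_1^2(x_1z_2-x_2z_1)+z_1^2(x_2y_1-x_1y_2)\big). \end{aligned}$$ *)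

theory Defs
  imports "HOL-Analysis.Analysis"
begin

text \<open>Distinctness is stated on the list of vertices because \<open>affine_dependent\<close> only sees
  the underlying set, in which repeated points collapse.\<close>

definition tetrahedron :: "real^3 \<Rightarrow> real^3 \<Rightarrow> real^3 \<Rightarrow> real^3 \<Rightarrow> bool" where
  "tetrahedron x y z w \<longleftrightarrow> distinct [x, y, z, w] \<and> \<not> affine_dependent {x, y, z, w}"

definition circumsphere :: "(real^3) set \<Rightarrow> real^3 \<Rightarrow> real \<Rightarrow> bool" where
  "circumsphere V q R \<longleftrightarrow> V \<subseteq> sphere q R"

text \<open>\<open>V\<close> is the set of vertices. As the ball lies inside the solid tetrahedron, a common point
  of the sphere and a face is a point of tangency, and it is the only one on that face.\<close>

definition insphere :: "(real^3) set \<Rightarrow> real^3 \<Rightarrow> real \<Rightarrow> bool" where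
  "insphere V p r \<longleftrightarrow>
     r > 0 \<and> cball p r \<subseteq> convex hull V \<and>
     (\<forall>v\<in>V. sphere p r \<inter> convex hull (V - {v}) \<noteq> {})"

text \<open>For points of the horizontal plane: viewed from above, i.e. the upward normal of the
  triangle is given by the right-hand rule.\<close>

definition counterclockwise :: "real^3 \<Rightarrow> real^3 \<Rightarrow> real^3 \<Rightarrow> bool" where
  "counterclockwise x y z \<longleftrightarrow> cross3 (y - x) (z - x) $ 3 > 0"

text \<open>Twice the signed area of the triangle \<open>pqs\<close> in the horizontal plane.\<close>

definition area2 :: "real^3 \<Rightarrow> real^3 \<Rightarrow> real^3 \<Rightarrow> real" where
  "area2 p q s = p$1 * q$2 + q$1 * s$2 + s$1 * p$2 - q$1 * p$2 - s$1 * q$2 - p$1 * s$2"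

definition a0 :: "real^3 \<Rightarrow> real^3 \<Rightarrow> real^3 \<Rightarrow> real" where
  "a0 x y z = area2 x y z"

definition coeff_A :: "real^3 \<Rightarrow> real^3 \<Rightarrow> real^3 \<Rightarrow> real^3 \<Rightarrow> real" where
  "coeff_A x y z c = area2 c y z * area2 x c z * area2 x y c"

definition coeff_B :: "real^3 \<Rightarrow> real^3 \<Rightarrow> real^3 \<Rightarrow> real^3 \<Rightarrow> real" where
  "coeff_B x y z c =
     (norm x)^2 * area2 c y z + (norm y)^2 * area2 x c z + (norm z)^2 * area2 x y c
     - (norm c)^2 * a0 x y z"

text \<open>The coordinates of the circumcenter of the triangle \<open>xyz\<close> in its plane.\<close>

definition o1 :: "real^3 \<Rightarrow> real^3 \<Rightarrow> real^3 \<Rightarrow> real" where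
  "o1 x y z =
     ((norm x)^2 * (y$2 - z$2) + (norm y)^2 * (z$2 - x$2) + (norm z)^2 * (x$2 - y$2))
     / (2 * a0 x y z)"

definition o2 :: "real^3 \<Rightarrow> real^3 \<Rightarrow> real^3 \<Rightarrow> real" where
  "o2 x y z =
     ((norm x)^2 * (z$1 - y$1) + (norm y)^2 * (x$1 - z$1) + (norm z)^2 * (y$1 - x$1))
     / (2 * a0 x y z)"

definition u1 :: "real^3 \<Rightarrow> real^3 \<Rightarrow> real^3 \<Rightarrow> real^3 \<Rightarrow> real" where
  "u1 x y z c = 4 * a0 x y z * (c$1 - o1 x y z)"

definition u2 :: "real^3 \<Rightarrow> real^3 \<Rightarrow> real^3 \<Rightarrow> real^3 \<Rightarrow> real" where
  "u2 x y z c = 4 * a0 x y z * (c$2 - o2 x y z)"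

definition v1 :: "real^3 \<Rightarrow> real^3 \<Rightarrow> real^3 \<Rightarrow> real^3 \<Rightarrow> real" where
  "v1 x y z c =
    (let x1 = x$1; x2 = x$2; y1 = y$1; y2 = y$2; z1 = z$1; z2 = z$2; c1 = c$1; c2 = c$2 in
       c1 * (c1^2 + c2^2) * a0 x y z - 2 * c1^2 * a0 x y z * o1 x y z
     + y1 * z1 * (y2 - z2) * (c1^2 - x1^2 - (c2 - x2)^2)
     + z1 * x1 * (z2 - x2) * (c1^2 - y1^2 - (c2 - y2)^2)
     + x1 * y1 * (x2 - y2) * (c1^2 - z1^2 - (c2 - z2)^2)
     + c1^2 * (x2^2 * (z2 - y2) + y2^2 * (x2 - z2) + z2^2 * (y2 - x2))
     + c2^2 * (x1^2 * (z2 - y2) + y1^2 * (x2 - z2) + z1^2 * (y2 - x2))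
     + x1^2 * (y2 - z2) * (c1 * (y1 + z1) + c2 * (y2 + z2) - y2 * z2)
     + y1^2 * (z2 - x2) * (c1 * (z1 + x1) + c2 * (z2 + x2) - z2 * x2)
     + z1^2 * (x2 - y2) * (c1 * (x1 + y1) + c2 * (x2 + y2) - x2 * y2)
     + 2 * c1 * c2 * (x1 * x2 * (y2 - z2) + y1 * y2 * (z2 - x2) + z1 * z2 * (x2 - y2))
     + 2 * c1 * c2 * (x1 * (z2^2 - y2^2) + y1 * (x2^2 - z2^2) + z1 * (y2^2 - x2^2))
     + c1 * (x1 * x2 * (z2^2 - y2^2) + y1 * y2 * (x2^2 - z2^2) + z1 * z2 * (y2^2 - x2^2))
     + 3 * c1 * (x1 * y2 * z2 * (y2 - z2) + x2 * y1 * z2 * (z2 - x2) + x2 * y2 * z1 * (x2 - y2)))"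

definition v2 :: "real^3 \<Rightarrow> real^3 \<Rightarrow> real^3 \<Rightarrow> real^3 \<Rightarrow> real" where
  "v2 x y z c =
    (let x1 = x$1; x2 = x$2; y1 = y$1; y2 = y$2; z1 = z$1; z2 = z$2; c1 = c$1; c2 = c$2 in
       c2 * (c1^2 + c2^2) * a0 x y z - 2 * c2^2 * a0 x y z * o2 x y z
     + y2 * z2 * (y1 - z1) * ((c1 - x1)^2 - c2^2 + x2^2)
     + x2 * z2 * (z1 - x1) * ((c1 - y1)^2 - c2^2 + y2^2)
     + x2 * y2 * (x1 - y1) * ((c1 - z1)^2 - c2^2 + z2^2)
     + c1^2 * (x2^2 * (y1 - z1) + y2^2 * (z1 - x1) + z2^2 * (x1 - y1))
     + c2^2 * (x1^2 * (y1 - z1) + y1^2 * (z1 - x1) + z1^2 * (x1 - y1))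
     + x2^2 * (z1 - y1) * (c1 * (y1 + z1) + c2 * (y2 + z2) - y1 * z1)
     + y2^2 * (x1 - z1) * (c1 * (z1 + x1) + c2 * (z2 + x2) - z1 * x1)
     + z2^2 * (y1 - x1) * (c1 * (x1 + y1) + c2 * (x2 + y2) - x1 * y1)
     + 2 * c1 * c2 * (x1 * x2 * (z1 - y1) + y1 * y2 * (x1 - z1) + z1 * z2 * (y1 - x1))
     + 2 * c1 * c2 * (x2 * (y1^2 - z1^2) + y2 * (z1^2 - x1^2) + z2 * (x1^2 - y1^2))
     + c2 * (x1 * x2 * (y1^2 - z1^2) + y1 * y2 * (z1^2 - x1^2) + z1 * z2 * (x1^2 - y1^2))
     + 3 * c2 * (x1^2 * (y2 * z1 - y1 * z2) + y1^2 * (x1 * z2 - x2 * z1)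
                 + z1^2 * (x2 * y1 - x1 * y2)))"

end

theory Submission
  imports Defs
begin

text \<open>
  The identity says that two computations of one number agree: both sides are rational functions
  of the data of the basic face (the triangle, the tangent point \<open>c\<close> and \<open>r\<close>), because these data
  determine the tetrahedron.

  Geometry enters in two ways. The ball touches the face over each edge of the basic triangle.
  Writing tangency as ``value at the incenter of the affine form vanishing on the face = \<open>r\<close> times
  the norm of its gradient'' gives one equation per edge (\<open>side_face_tangency\<close>). In its square, the
  square of the area spanned by the edge and the projection of \<open>w\<close> cancels, so that the equation is
  linear in this area. It yields the barycentric coordinates of the projection, each proportional
  to \<open>w$3\<close>. That they sum to \<open>1\<close> says \<open>w$3 (A - B r\<^sup>2) = 2 r A\<close>, so the denominator on the
  right-hand side is positive. Secondly, the circumcenter lies above the circumcenter of the basic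
  triangle, and equidistance from \<open>w\<close> fixes its height \<open>h\<close>.

  Now let \<open>P = B / a0\<close>, which is minus the power of \<open>c\<close> with respect to the circumcircle, and let
  \<open>\<rho>\<close> be the radius of this circle. As \<open>R\<^sup>2 = \<rho>\<^sup>2 + h\<^sup>2\<close> and \<open>R\<^sup>2 - d\<^sup>2 = P + 2 r h - r\<^sup>2\<close>, the term
  \<open>h\<^sup>2\<close> drops out:
  \[ (R^2 - d^2 - 3 r^2)^2 - (2 r R)^2 = (P - 4 r^2)^2 + 4 r h (P - 4 r^2) - 4 r^2 \rho^2 . \]

  On the other side, the long polynomials \<open>v1\<close>, \<open>v2\<close> become transparent when \<open>c\<close> is taken as the
  origin: \<open>(u1 t + v1, u2 t + v2)\<close> is, up to a quarter turn, the cyclic sum of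
  \<open>\<parallel>x\<parallel>\<^sup>2 (2 t + y \<bullet> z) (y - z)\<close> (\<open>u1_v1_eq_cyclic_sum\<close>, \<open>u2_v2_eq_cyclic_sum\<close>). Its norm depends only
  on \<open>t\<close>, the Gram matrix of two edge vectors and the barycentric coordinates of \<open>c\<close>. At \<open>t = r\<^sup>2\<close>
  the left-hand side depends on the same six numbers, and what remains is a polynomial identity in
  them (\<open>gram_barycentric_identity\<close>).
\<close>

section \<open>Tangency of a ball to a half-space\<close>

text \<open>The ball reaches down to \<open>n \<bullet> p - r * norm n\<close>, which bounds the distance from below;
  the common point, at distance \<open>r\<close> from the centre, bounds it from above by Cauchy-Schwarz.\<close>

lemma tangent_halfspace:
  fixes n p q :: "'a::real_inner"
  assumes "r > 0" and ball: "cball p r \<subseteq> {u. n \<bullet> u \<ge> k}"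
    and q: "q \<in> sphere p r" "n \<bullet> q = k"
  shows "n \<bullet> p - k = r * norm n"
proof (cases "n = 0")
  case True
  then show ?thesis using q by simp
next
  case False
  have "p - (r / norm n) *\<^sub>R n \<in> cball p r"
    using False \<open>r > 0\<close> by (simp add: dist_norm)
  with ball have "n \<bullet> (p - (r / norm n) *\<^sub>R n) \<ge> k"
    by blast
  moreover have "n \<bullet> (p - (r / norm n) *\<^sub>R n) = n \<bullet> p - r * norm n"
    using False by (simp add: inner_diff_right dot_square_norm power2_eq_square)
  moreover have "n \<bullet> p - k \<le> norm n * r"
    using norm_cauchy_schwarz[of n "p - q"] q by (simp add: inner_diff_right dist_norm)
  ultimately show ?thesis by (simp add: mult.commute)
qed

lemma hull_ge:
  assumes "\<And>v. v \<in> V \<Longrightarrow> n \<bullet> v \<ge> (k::real)"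
  shows "convex hull V \<subseteq> {u. n \<bullet> u \<ge> k}"
  using assms by (intro hull_minimal convex_halfspace_ge) auto

lemma hull_eq:
  assumes "\<And>v. v \<in> V \<Longrightarrow> n \<bullet> v = (k::real)"
  shows "convex hull V \<subseteq> {u. n \<bullet> u = k}"
  using assms by (intro hull_minimal convex_hyperplane) auto

section \<open>The faces of the tetrahedron\<close>

lemma inner_vector_3: "vector [a, b, c] \<bullet> (u :: real^3) = a * u$1 + b * u$2 + c * u$3"
  by (simp add: inner_vec_def sum_3)

lemma hull_horizontal:
  fixes x y z :: "real^3"
  assumes "x$3 = 0" "y$3 = 0" "z$3 = 0" and c: "c \<in> convex hull {x, y, z}"
  shows "c$3 = 0"
proof -
  have "convex hull {x, y, z} \<subseteq> {u. vector [0, 0, 1] \<bullet> u = (0::real)}"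
    using assms by (intro hull_eq) (auto simp: inner_vector_3)
  with c show ?thesis by (auto simp: inner_vector_3)
qed

lemma area2_nonneg:
  assumes "area2 x y z > 0" and c: "c \<in> convex hull {x, y, z}"
  shows "area2 x y c \<ge> 0"
proof -
  define n :: "real^3" where "n = vector [x$2 - y$2, y$1 - x$1, 0]"
  have n: "area2 x y u = n \<bullet> u - (y$1 * x$2 - x$1 * y$2)" for u
    by (simp add: area2_def n_def inner_vector_3 algebra_simps)
  have "area2 x y x = 0" "area2 x y y = 0"
    by (simp_all add: area2_def)
  then have "convex hull {x, y, z} \<subseteq> {u. n \<bullet> u \<ge> y$1 * x$2 - x$1 * y$2}"
    using assms(1) by (intro hull_ge) (auto simp: n)
  with c show ?thesis by (auto simp: n)
qed

lemma incenter_above_tangent_point: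
  fixes x y z w p c :: "real^3"
  assumes "x$3 = 0" "y$3 = 0" "z$3 = 0" "w$3 > 0" "r > 0"
    and ball: "cball p r \<subseteq> convex hull {x, y, z, w}"
    and c: "c \<in> sphere p r \<inter> convex hull {x, y, z}"
  shows "p$1 = c$1" "p$2 = c$2" "p$3 = r"
proof -
  have c3: "c$3 = 0"
    using hull_horizontal[of x y z c] assms by auto
  have "convex hull {x, y, z, w} \<subseteq> {u. vector [0, 0, 1] \<bullet> u \<ge> (0::real)}"
    using assms by (intro hull_ge) (auto simp: inner_vector_3)
  with ball have "cball p r \<subseteq> {u. vector [0, 0, 1] \<bullet> u \<ge> (0::real)}"
    by blast
  then have "vector [0, 0, 1] \<bullet> p - 0 = r * norm (vector [0, 0, 1] :: real^3)"
    using c c3 \<open>r > 0\<close> by (intro tangent_halfspace[where q = c]) (auto simp: inner_vector_3)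
  then show p3: "p$3 = r"
    by (simp add: inner_vector_3 norm_vec_def L2_set_def sum_3)
  have "(norm (p - c))\<^sup>2 = r\<^sup>2"
    using c by (simp add: dist_norm)
  then have "(p$1 - c$1)\<^sup>2 + (p$2 - c$2)\<^sup>2 = 0"
    unfolding power2_norm_eq_inner
    by (simp add: inner_vec_def sum_3 c3 p3 flip: power2_eq_square)
  then show "p$1 = c$1" "p$2 = c$2"
    by (simp_all add: sum_power2_eq_zero_iff)
qed

text \<open>The face \<open>xyw\<close> is the zero set of \<open>u \<mapsto> w$3 * area2 x y u - area2 x y w * u$3\<close>. Squaring the
  tangency condition for this form, \<open>(area2 x y w)\<^sup>2 * r\<^sup>2\<close> cancels and one factor \<open>w$3\<close>
  can be removed.\<close>

lemma side_face_tangency: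
  fixes x y z w p c :: "real^3"
  assumes "x$3 = 0" "y$3 = 0" "z$3 = 0" "w$3 > 0" "r > 0" and pos: "area2 x y z > 0"
    and ball: "cball p r \<subseteq> convex hull {x, y, z, w}"
    and touch: "sphere p r \<inter> convex hull {x, y, w} \<noteq> {}"
    and p: "p$1 = c$1" "p$2 = c$2" "p$3 = r"
  shows "w$3 * (area2 x y c)\<^sup>2
       = 2 * r * area2 x y c * area2 x y w + r\<^sup>2 * w$3 * ((y$1 - x$1)\<^sup>2 + (y$2 - x$2)\<^sup>2)"
proof -
  define n :: "real^3"
    where "n = vector [w$3 * (x$2 - y$2), w$3 * (y$1 - x$1), - area2 x y w]"
  define k where "k = w$3 * (y$1 * x$2 - x$1 * y$2)"
  have n: "n \<bullet> u - k = w$3 * area2 x y u - area2 x y w * u$3" for u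
    by (simp add: area2_def n_def k_def inner_vector_3 algebra_simps)
  have zero: "n \<bullet> x = k" "n \<bullet> y = k" "n \<bullet> w = k"
    using n[of x] n[of y] n[of w] assms by (simp_all add: area2_def)
  have "n \<bullet> z - k > 0"
    using n[of z] assms by simp
  then have "cball p r \<subseteq> {u. n \<bullet> u \<ge> k}"
    using ball zero hull_ge[of "{x, y, z, w}" k n] by force
  moreover obtain q where "q \<in> sphere p r" "q \<in> convex hull {x, y, w}"
    using touch by blast
  moreover have "convex hull {x, y, w} \<subseteq> {u. n \<bullet> u = k}"
    using zero by (intro hull_eq) auto
  ultimately have "n \<bullet> p - k = r * norm n"
    using \<open>r > 0\<close> by (intro tangent_halfspace[where q = q]) auto
  then have "(n \<bullet> p - k)\<^sup>2 = r\<^sup>2 * (n \<bullet> n)"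
    by (simp add: power_mult_distrib power2_norm_eq_inner)
  moreover have "area2 x y p = area2 x y c"
    by (simp add: area2_def p)
  moreover have "n \<bullet> n = (w$3)\<^sup>2 * ((y$1 - x$1)\<^sup>2 + (y$2 - x$2)\<^sup>2) + (area2 x y w)\<^sup>2"
    by (simp add: n_def inner_vector_3 power2_eq_square algebra_simps)
  ultimately have "w$3 * (w$3 * (area2 x y c)\<^sup>2)
      = w$3 * (2 * r * area2 x y c * area2 x y w
               + r\<^sup>2 * w$3 * ((y$1 - x$1)\<^sup>2 + (y$2 - x$2)\<^sup>2))"
    unfolding n p by algebra
  with \<open>w$3 > 0\<close> show ?thesis by simp
qed

section \<open>The cyclic sum behind \<open>u\<close> and \<open>v\<close>\<close>

definition cyclic_weight :: "real \<Rightarrow> real^3 \<Rightarrow> real^3 \<Rightarrow> real^3 \<Rightarrow> real^3 \<Rightarrow> real" where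
  "cyclic_weight t c x y z = (norm (x - c))\<^sup>2 * (2 * t + (y - c) \<bullet> (z - c))"

lemma power2_norm_3: "(norm (u :: real^3))\<^sup>2 = (u$1)\<^sup>2 + (u$2)\<^sup>2 + (u$3)\<^sup>2"
  unfolding power2_norm_eq_inner by (simp add: inner_vec_def sum_3 power2_eq_square)

lemma inner_3: "(u :: real^3) \<bullet> v = u$1 * v$1 + u$2 * v$2 + u$3 * v$3"
  by (simp add: inner_vec_def sum_3)

text \<open>In the definitions the circumcenter coordinates occur only multiplied by \<open>a0\<close>, which clears
  their denominator, so both sides are polynomials and can be compared by expansion. The right-hand
  sides involve differences of points only: they exhibit the invariance of \<open>v1\<close>, \<open>v2\<close> under
  translations of the plane, and put \<open>c\<close> at the origin.\<close>

lemma u1_v1_eq_cyclic_sum: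
  assumes "x$3 = 0" "y$3 = 0" "z$3 = 0" "c$3 = 0" "a0 x y z \<noteq> 0"
  shows "u1 x y z c * t + v1 x y z c =
    - (cyclic_weight t c x y z * (y$2 - z$2) + cyclic_weight t c y z x * (z$2 - x$2)
       + cyclic_weight t c z x y * (x$2 - y$2))"
proof -
  have o1: "2 * (a0 x y z * o1 x y z) = ((x$1)\<^sup>2 + (x$2)\<^sup>2) * (y$2 - z$2)
      + ((y$1)\<^sup>2 + (y$2)\<^sup>2) * (z$2 - x$2) + ((z$1)\<^sup>2 + (z$2)\<^sup>2) * (x$2 - y$2)"
    using assms by (simp add: o1_def power2_norm_3)
  have a0: "a0 x y z = x$1 * y$2 + y$1 * z$2 + z$1 * x$2 - y$1 * x$2 - z$1 * y$2 - x$1 * z$2"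
    by (simp add: a0_def area2_def)
  show ?thesis
    unfolding u1_def v1_def cyclic_weight_def Let_def power2_norm_3 inner_3 vector_minus_component
    using assms(1-4) o1 a0 by algebra
qed

lemma u2_v2_eq_cyclic_sum:
  assumes "x$3 = 0" "y$3 = 0" "z$3 = 0" "c$3 = 0" "a0 x y z \<noteq> 0"
  shows "u2 x y z c * t + v2 x y z c =
    cyclic_weight t c x y z * (y$1 - z$1) + cyclic_weight t c y z x * (z$1 - x$1)
    + cyclic_weight t c z x y * (x$1 - y$1)"
proof -
  have o2: "2 * (a0 x y z * o2 x y z) = ((x$1)\<^sup>2 + (x$2)\<^sup>2) * (z$1 - y$1)
      + ((y$1)\<^sup>2 + (y$2)\<^sup>2) * (x$1 - z$1) + ((z$1)\<^sup>2 + (z$2)\<^sup>2) * (y$1 - x$1)"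
    using assms by (simp add: o2_def power2_norm_3)
  have a0: "a0 x y z = x$1 * y$2 + y$1 * z$2 + z$1 * x$2 - y$1 * x$2 - z$1 * y$2 - x$1 * z$2"
    by (simp add: a0_def area2_def)
  show ?thesis
    unfolding u2_def v2_def cyclic_weight_def Let_def power2_norm_3 inner_3 vector_minus_component
    using assms(1-4) o2 a0 by algebra
qed

section \<open>The tetrahedron in barycentric coordinates\<close>

lemma area2_rotate: "area2 q s p = area2 p q s"
  by (simp add: area2_def)

text \<open>Barycentric coordinates are ratios of areas; \<open>b\<close> and \<open>g\<close> are those belonging to \<open>y\<close> and \<open>z\<close>.\<close>

lemma planar_barycentric:
  fixes x y z u :: "real^3"
  assumes "area2 x y z \<noteq> 0"
  defines "b \<equiv> area2 x u z / area2 x y z" and "g \<equiv> area2 x y u / area2 x y z"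
  shows "u$1 = x$1 + b * (y$1 - x$1) + g * (z$1 - x$1)"
    and "u$2 = x$2 + b * (y$2 - x$2) + g * (z$2 - x$2)"
    and "area2 u y z / area2 x y z = 1 - b - g"
proof -
  have "area2 x y z * b = area2 x u z" "area2 x y z * g = area2 x y u"
    using assms(1) by (simp_all add: b_def g_def)
  then have "area2 x y z * u$1 = area2 x y z * (x$1 + b * (y$1 - x$1) + g * (z$1 - x$1))"
    "area2 x y z * u$2 = area2 x y z * (x$2 + b * (y$2 - x$2) + g * (z$2 - x$2))"
    "area2 u y z = area2 x y z * (1 - b - g)"
    unfolding area2_def by algebra+
  then show "u$1 = x$1 + b * (y$1 - x$1) + g * (z$1 - x$1)"
    "u$2 = x$2 + b * (y$2 - x$2) + g * (z$2 - x$2)"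
    "area2 u y z / area2 x y z = 1 - b - g"
    using assms(1) by simp_all
qed

text \<open>The tangency equations express \<open>a'\<close>, \<open>b'\<close>, \<open>g'\<close> through \<open>m\<close>; their sum \<open>1\<close> then gives \<open>m\<close>, and
  substituting into the equidistance equation gives \<open>h\<close>. In the application \<open>E\<close>, \<open>G\<close>, \<open>F\<close> are the
  squared edges \<open>xy\<close>, \<open>xz\<close>, \<open>yz\<close>, and \<open>D\<close> is the square of twice the area of the triangle;
  \<open>(a, b, g)\<close> and \<open>(a', b', g')\<close> are the barycentric coordinates of \<open>c\<close> and of the projection
  of \<open>w\<close>; \<open>h\<close> and \<open>m\<close> are the heights of circumcenter and apex.\<close>

lemma heights_of_apex_and_circumcenter:
  fixes a b g a' b' g' E F G D m h r :: real
  defines "P \<equiv> a * b * E + a * g * G + b * g * F"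
  assumes pos: "a > 0" "b > 0" "g > 0" "D > 0" "m > 0" "r > 0"
    and sum: "a + b + g = 1" "a' + b' + g' = 1"
    and tan_yz: "m * (D * a\<^sup>2) = 2 * r * D * a * a' + r\<^sup>2 * m * F"
    and tan_zx: "m * (D * b\<^sup>2) = 2 * r * D * b * b' + r\<^sup>2 * m * G"
    and tan_xy: "m * (D * g\<^sup>2) = 2 * r * D * g * g' + r\<^sup>2 * m * E"
    and equidistant: "2 * h * m = m\<^sup>2 - (a' * b' * E + a' * g' * G + b' * g' * F)"
  shows "m * (D * (a * b * g) - P * r\<^sup>2) = 2 * r * D * (a * b * g)"
    and "4 * r * h * D * (D * (a * b * g) - P * r\<^sup>2) = 4 * r\<^sup>2 * D\<^sup>2 * (a * b * g)
      - (g * E * (D * a\<^sup>2 - r\<^sup>2 * F) * (D * b\<^sup>2 - r\<^sup>2 * G)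
         + b * G * (D * a\<^sup>2 - r\<^sup>2 * F) * (D * g\<^sup>2 - r\<^sup>2 * E)
         + a * F * (D * b\<^sup>2 - r\<^sup>2 * G) * (D * g\<^sup>2 - r\<^sup>2 * E))" (is "_ = _ - ?S")
proof -
  have "m * (D * (a * b * g) - P * r\<^sup>2)
      = b * g * (m * (D * a\<^sup>2 - r\<^sup>2 * F)) + a * g * (m * (D * b\<^sup>2 - r\<^sup>2 * G))
        + a * b * (m * (D * g\<^sup>2 - r\<^sup>2 * E))"
    using sum unfolding P_def by algebra
  also have "\<dots> = 2 * r * D * (a * b * g)"
    using tan_yz tan_zx tan_xy sum by algebra
  finally show m: "m * (D * (a * b * g) - P * r\<^sup>2) = 2 * r * D * (a * b * g)" .
  have "m * (m * ?S) = g * E * (2 * r * D * a * a') * (2 * r * D * b * b')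
      + b * G * (2 * r * D * a * a') * (2 * r * D * g * g')
      + a * F * (2 * r * D * b * b') * (2 * r * D * g * g')"
    using tan_yz tan_zx tan_xy by algebra
  then have "m * (8 * h * (r\<^sup>2 * D\<^sup>2 * (a * b * g))) = m * (m * (4 * r\<^sup>2 * D\<^sup>2 * (a * b * g) - ?S))"
    using equidistant by algebra
  then have h: "8 * h * (r\<^sup>2 * D\<^sup>2 * (a * b * g)) = m * (4 * r\<^sup>2 * D\<^sup>2 * (a * b * g) - ?S)"
    using \<open>m > 0\<close> by simp
  have "(2 * r * D * (a * b * g)) * (4 * r * h * D * (D * (a * b * g) - P * r\<^sup>2))
      = 8 * h * (r\<^sup>2 * D\<^sup>2 * (a * b * g)) * (D * (a * b * g) - P * r\<^sup>2)"
    by algebra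
  also have "\<dots> = (2 * r * D * (a * b * g)) * (4 * r\<^sup>2 * D\<^sup>2 * (a * b * g) - ?S)"
    using h m by algebra
  finally show "4 * r * h * D * (D * (a * b * g) - P * r\<^sup>2) = 4 * r\<^sup>2 * D\<^sup>2 * (a * b * g) - ?S"
    using pos by simp
qed

text \<open>The left-hand side is \<open>(P - 4 t)\<^sup>2 + 4 r h (P - 4 t) - 4 t \<rho>\<^sup>2\<close> times the common denominator, with
  \<open>4 D \<rho>\<^sup>2 = E F G\<close> and the height \<open>h\<close> substituted. The right-hand side is \<open>t\<close> times the squared norm
  of the cyclic sum, written as a combination of the edge vectors \<open>y - x\<close> and \<open>z - x\<close>: with \<open>c\<close> as
  origin, \<open>p\<close> is \<open>\<parallel>x\<parallel>\<^sup>2\<close>, \<open>m\<close> and \<open>n\<close> are minus the inner products of \<open>x\<close> with these vectors, and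
  \<open>k1\<close>, \<open>k2\<close>, \<open>k3\<close> are the three weights.\<close>

lemma gram_barycentric_identity:
  fixes E G H b g t :: real
  defines "a \<equiv> 1 - b - g" and "F \<equiv> E + G - 2 * H" and "D \<equiv> E * G - H\<^sup>2"
  defines "p \<equiv> b\<^sup>2 * E + 2 * b * g * H + g\<^sup>2 * G"
  defines "m \<equiv> b * E + g * H" and "n \<equiv> b * H + g * G"
  defines "P \<equiv> a * b * E + a * g * G + b * g * F"
  defines "k1 \<equiv> p * (2 * t + (p - m - n + H))"
    and "k2 \<equiv> (p - 2 * m + E) * (2 * t + (p - n))"
    and "k3 \<equiv> (p - 2 * n + G) * (2 * t + (p - m))"
  shows "(D * (a * b * g) - P * t) * (D * (P - 4 * t)\<^sup>2 - t * (E * F * G))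
      + (P - 4 * t) * (4 * t * D\<^sup>2 * (a * b * g)
        - (g * E * (D * a\<^sup>2 - t * F) * (D * b\<^sup>2 - t * G)
           + b * G * (D * a\<^sup>2 - t * F) * (D * g\<^sup>2 - t * E)
           + a * F * (D * b\<^sup>2 - t * G) * (D * g\<^sup>2 - t * E)))
    = t * ((k1 - k3)\<^sup>2 * E + 2 * (k1 - k3) * (k2 - k1) * H + (k2 - k1)\<^sup>2 * G)"
  unfolding assms by algebra

section \<open>The theorem\<close>

theorem theorem1:
  fixes x y z w c incenter circumcenter :: "real^3" and r R d :: real
  assumes "tetrahedron x y z w"
    and "x $ 3 = 0" and "y $ 3 = 0" and "z $ 3 = 0" and "w $ 3 > 0"
    and "counterclockwise x y z"
    and "insphere {x, y, z, w} incenter r"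
    and "circumsphere {x, y, z, w} circumcenter R"
    and "d = dist incenter circumcenter"
    and "c \<in> sphere incenter r \<inter> convex hull {x, y, z}"
  shows "a0 x y z > 0 \<and> coeff_A x y z c > 0 \<and> coeff_B x y z c > 0 \<and>
    (R^2 - d^2 - 3 * r^2)^2 - (2 * r * R)^2 =
      r^2 * (((u1 x y z c * r^2 + v1 x y z c)^2 + (u2 x y z c * r^2 + v2 x y z c)^2)
             / (a0 x y z * (coeff_A x y z c - coeff_B x y z c * r^2)))"
proof -
  note flat = assms(2-4)
  define S where "S = area2 x y z"
  have S: "S > 0"
    using assms(6) by (simp add: S_def counterclockwise_def area2_def cross3_def algebra_simps)
  have a0: "a0 x y z = S"
    by (simp add: a0_def S_def)
  have r: "r > 0" and ball: "cball incenter r \<subseteq> convex hull {x, y, z, w}"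
    and touch: "\<And>v. v \<in> {x, y, z, w} \<Longrightarrow>
      sphere incenter r \<inter> convex hull ({x, y, z, w} - {v}) \<noteq> {}"
    using assms(7) by (auto simp: insphere_def)
  have c: "c \<in> convex hull {x, y, z}" and c3: "c$3 = 0"
    using assms(10) hull_horizontal[OF flat] by auto
  note inc = incenter_above_tangent_point[OF flat assms(5) r ball assms(10)]
  have ne: "x \<noteq> y" "y \<noteq> z" "z \<noteq> x" "x \<noteq> w" "y \<noteq> w" "z \<noteq> w"
    using assms(1) by (auto simp: tetrahedron_def)

  have xy: "w$3 * (area2 x y c)\<^sup>2 = 2 * r * area2 x y c * area2 x y w
      + r\<^sup>2 * w$3 * ((y$1 - x$1)\<^sup>2 + (y$2 - x$2)\<^sup>2)"
  proof (rule side_face_tangency[OF flat assms(5) r _ ball _ inc])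
    show "sphere incenter r \<inter> convex hull {x, y, w} \<noteq> {}"
      using touch[of z] ne by (simp add: insert_Diff_if)
  qed (use S S_def in simp)
  have yz: "w$3 * (area2 y z c)\<^sup>2 = 2 * r * area2 y z c * area2 y z w
      + r\<^sup>2 * w$3 * ((z$1 - y$1)\<^sup>2 + (z$2 - y$2)\<^sup>2)"
  proof (rule side_face_tangency[OF flat(2,3,1) assms(5) r _ _ _ inc])
    show "sphere incenter r \<inter> convex hull {y, z, w} \<noteq> {}"
      using touch[of x] ne by (simp add: insert_Diff_if)
    show "cball incenter r \<subseteq> convex hull {y, z, x, w}"
      using ball by (simp add: insert_commute)
  qed (use S S_def area2_rotate in simp)
  have zx: "w$3 * (area2 z x c)\<^sup>2 = 2 * r * area2 z x c * area2 z x w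
      + r\<^sup>2 * w$3 * ((x$1 - z$1)\<^sup>2 + (x$2 - z$2)\<^sup>2)"
  proof (rule side_face_tangency[OF flat(3,1,2) assms(5) r _ _ _ inc])
    show "sphere incenter r \<inter> convex hull {z, x, w} \<noteq> {}"
      using touch[of y] ne by (simp add: insert_Diff_if insert_commute)
    show "cball incenter r \<subseteq> convex hull {z, x, y, w}"
      using ball by (simp add: insert_commute)
  qed (use S S_def area2_rotate in metis)

  define e1 e2 f1 f2 where ef: "e1 = y$1 - x$1" "e2 = y$2 - x$2" "f1 = z$1 - x$1" "f2 = z$2 - x$2"
  define E G H F D where gram: "E = e1\<^sup>2 + e2\<^sup>2" "G = f1\<^sup>2 + f2\<^sup>2" "H = e1 * f1 + e2 * f2"
    "F = E + G - 2 * H" "D = E * G - H\<^sup>2"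
  have S_eq: "S = e1 * f2 - e2 * f1"
    by (simp add: S_def ef area2_def algebra_simps)
  have D: "D = S\<^sup>2"
    unfolding gram S_eq by algebra
  have D_pos: "D > 0"
    using S D by simp
  have edges: "(y$1 - x$1)\<^sup>2 + (y$2 - x$2)\<^sup>2 = E" "(z$1 - y$1)\<^sup>2 + (z$2 - y$2)\<^sup>2 = F"
    "(x$1 - z$1)\<^sup>2 + (x$2 - z$2)\<^sup>2 = G"
    unfolding gram ef by algebra+

  define a b g where bary: "a = area2 c y z / S" "b = area2 x c z / S" "g = area2 x y c / S"
  define a' b' g' where bary': "a' = area2 w y z / S" "b' = area2 x w z / S" "g' = area2 x y w / S"
  have sum: "a = 1 - b - g" "a' = 1 - b' - g'"
    and c_eq: "c$1 = x$1 + b * e1 + g * f1" "c$2 = x$2 + b * e2 + g * f2"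
    and w_eq: "w$1 = x$1 + b' * e1 + g' * f1" "w$2 = x$2 + b' * e2 + g' * f2"
    using planar_barycentric[of x y z c] planar_barycentric[of x y z w] S
    unfolding S_def bary bary' ef by simp_all
  have area_c: "area2 y z c = S * a" "area2 z x c = S * b" "area2 x y c = S * g"
    "area2 c y z = S * a" "area2 x c z = S * b"
    and area_w: "area2 y z w = S * a'" "area2 z x w = S * b'" "area2 x y w = S * g'"
    using S unfolding bary bary' by (simp_all add: area2_def)
  have tan: "w$3 * (D * a\<^sup>2) = 2 * r * D * a * a' + r\<^sup>2 * w$3 * F"
    "w$3 * (D * b\<^sup>2) = 2 * r * D * b * b' + r\<^sup>2 * w$3 * G"
    "w$3 * (D * g\<^sup>2) = 2 * r * D * g * g' + r\<^sup>2 * w$3 * E"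
    using yz zx xy unfolding edges area_c area_w D by algebra+
  have edges_pos: "E > 0" "F > 0" "G > 0"
  proof -
    have "E \<ge> 0" "F \<ge> 0" "G \<ge> 0"
      unfolding edges[symmetric] by simp_all
    moreover have "E \<noteq> 0" "G \<noteq> 0"
      using D_pos unfolding gram(5) by (auto simp: not_less)
    moreover have "D = E * F - (E - H)\<^sup>2"
      unfolding gram by algebra
    then have "F \<noteq> 0"
      using D_pos by (auto simp: not_less)
    ultimately show "E > 0" "F > 0" "G > 0" by simp_all
  qed
  have nonneg: "a \<ge> 0" "b \<ge> 0" "g \<ge> 0"
  proof -
    have "area2 y z c \<ge> 0"
      using area2_nonneg[of y z x c] c S by (simp add: S_def insert_commute area2_rotate)
    moreover have "area2 z x c \<ge> 0"
      using area2_nonneg[of z x y c] c S area2_rotate[of y z x] area2_rotate[of x y z]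
      by (simp add: S_def insert_commute)
    moreover have "area2 x y c \<ge> 0"
      using area2_nonneg[of x y z c] c S by (simp add: S_def)
    ultimately show "a \<ge> 0" "b \<ge> 0" "g \<ge> 0"
      using S unfolding area_c by (simp_all add: zero_le_mult_iff)
  qed
  \<comment> \<open>A vanishing coordinate would turn its tangency equation into \<open>r\<^sup>2 * w$3 * edge\<^sup>2 = 0\<close>.\<close>
  have abg_pos: "a > 0" "b > 0" "g > 0"
  proof -
    have "a \<noteq> 0" "b \<noteq> 0" "g \<noteq> 0"
      using tan edges_pos r assms(5) by auto
    with nonneg show "a > 0" "b > 0" "g > 0" by simp_all
  qed

  \<comment> \<open>By the Lagrange identity \<open>P\<close> is the weighted mean of the squared distances from \<open>c\<close> to the
    vertices; in this form its positivity is visible.\<close>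
  define P where "P = a * b * E + a * g * G + b * g * F"
  have P_pos: "P > 0"
    unfolding P_def using abg_pos edges_pos by (intro add_pos_pos mult_pos_pos)
  have A: "coeff_A x y z c = S * (D * (a * b * g))"
    unfolding coeff_A_def area_c D by algebra
  have yz_eq: "y$1 = x$1 + e1" "y$2 = x$2 + e2" "z$1 = x$1 + f1" "z$2 = x$2 + f2"
    by (simp_all add: ef)
  have B: "coeff_B x y z c = S * P"
    unfolding coeff_B_def area_c a0 P_def power2_norm_3 flat c3 c_eq yz_eq sum gram by algebra

  define h where "h = circumcenter$3"
  define q1 q2 where q: "q1 = circumcenter$1 - x$1" "q2 = circumcenter$2 - x$2"
  have on_sphere: "(norm (v - circumcenter))\<^sup>2 = R\<^sup>2" if "v \<in> {x, y, z, w}" for v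
    using assms(8) that by (auto simp: circumsphere_def dist_norm norm_minus_commute)
  have "(x$1 - circumcenter$1)\<^sup>2 + (x$2 - circumcenter$2)\<^sup>2 + h\<^sup>2 = R\<^sup>2"
    "(y$1 - circumcenter$1)\<^sup>2 + (y$2 - circumcenter$2)\<^sup>2 + h\<^sup>2 = R\<^sup>2"
    "(z$1 - circumcenter$1)\<^sup>2 + (z$2 - circumcenter$2)\<^sup>2 + h\<^sup>2 = R\<^sup>2"
    "(w$1 - circumcenter$1)\<^sup>2 + (w$2 - circumcenter$2)\<^sup>2 + (w$3 - h)\<^sup>2 = R\<^sup>2"
    using on_sphere[of x] on_sphere[of y] on_sphere[of z] on_sphere[of w]
    by (simp_all add: power2_norm_3 flat h_def)
  then have qx: "q1\<^sup>2 + q2\<^sup>2 + h\<^sup>2 = R\<^sup>2"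
    and qy: "2 * (e1 * q1 + e2 * q2) = E" and qz: "2 * (f1 * q1 + f2 * q2) = G"
    and qw: "(b' * e1 + g' * f1 - q1)\<^sup>2 + (b' * e2 + g' * f2 - q2)\<^sup>2 + (w$3 - h)\<^sup>2 = R\<^sup>2"
    unfolding w_eq yz_eq gram q by algebra+
  have equidistant: "2 * h * w$3 = (w$3)\<^sup>2 - (a' * b' * E + a' * g' * G + b' * g' * F)"
    using qx qy qz qw unfolding sum gram by algebra
  \<comment> \<open>The square of the classical formula: the product of the edges is four times the area times
    the circumradius of the triangle.\<close>
  have circumradius: "4 * D * (R\<^sup>2 - h\<^sup>2) = E * F * G"
    using qx qy qz unfolding gram by algebra
  have "d\<^sup>2 = (c$1 - circumcenter$1)\<^sup>2 + (c$2 - circumcenter$2)\<^sup>2 + (r - h)\<^sup>2"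
    unfolding assms(9) dist_norm power2_norm_3 by (simp add: inc h_def)
  then have "d\<^sup>2 = (b * e1 + g * f1 - q1)\<^sup>2 + (b * e2 + g * f2 - q2)\<^sup>2 + (r - h)\<^sup>2"
    unfolding c_eq q by algebra
  \<comment> \<open>Expanded around \<open>x\<close>, the difference contains the circumcenter only in its height and in its
    inner products with the two edge vectors, which \<open>qy\<close> and \<open>qz\<close> evaluate.\<close>
  then have d: "R\<^sup>2 - d\<^sup>2 = P + 2 * r * h - r\<^sup>2"
    using qx qy qz unfolding P_def sum gram by algebra

  define K where "K = D * (a * b * g) - P * r\<^sup>2"
  have "a + b + g = 1" "a' + b' + g' = 1"
    using sum by simp_all
  note heights = heights_of_apex_and_circumcenter[OF abg_pos D_pos assms(5) r this tan equidistant,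
      folded P_def K_def]
  have K_pos: "K > 0"
  proof -
    have "w$3 * K > 0"
      using heights(1) abg_pos D_pos r by simp
    with assms(5) show ?thesis by (simp add: zero_less_mult_iff)
  qed

  define p m n where pmn: "p = b\<^sup>2 * E + 2 * b * g * H + g\<^sup>2 * G"
    "m = b * E + g * H" "n = b * H + g * G"
  define k1 k2 k3 where k: "k1 = p * (2 * r\<^sup>2 + (p - m - n + H))"
    "k2 = (p - 2 * m + E) * (2 * r\<^sup>2 + (p - n))" "k3 = (p - 2 * n + G) * (2 * r\<^sup>2 + (p - m))"
  have norms: "(norm (x - c))\<^sup>2 = p" "(norm (y - c))\<^sup>2 = p - 2 * m + E"
    "(norm (z - c))\<^sup>2 = p - 2 * n + G"
    unfolding power2_norm_3 pmn gram by (simp_all add: flat c3 c_eq yz_eq) algebra+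
  have inners: "(y - c) \<bullet> (z - c) = p - m - n + H" "(z - c) \<bullet> (x - c) = p - n"
    "(x - c) \<bullet> (y - c) = p - m"
    unfolding inner_3 pmn gram by (simp_all add: flat c3 c_eq yz_eq) algebra+
  have weights: "cyclic_weight (r\<^sup>2) c x y z = k1" "cyclic_weight (r\<^sup>2) c y z x = k2"
    "cyclic_weight (r\<^sup>2) c z x y = k3"
    unfolding cyclic_weight_def k norms inners by simp_all
  have "u1 x y z c * r\<^sup>2 + v1 x y z c = - ((k1 - k3) * e2 + (k2 - k1) * f2)"
    using u1_v1_eq_cyclic_sum[OF flat c3, of "r\<^sup>2"] S
    unfolding a0 weights yz_eq by (simp add: algebra_simps)
  moreover have "u2 x y z c * r\<^sup>2 + v2 x y z c = (k1 - k3) * e1 + (k2 - k1) * f1"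
    using u2_v2_eq_cyclic_sum[OF flat c3, of "r\<^sup>2"] S
    unfolding a0 weights yz_eq by (simp add: algebra_simps)
  ultimately have "(u1 x y z c * r\<^sup>2 + v1 x y z c)\<^sup>2 + (u2 x y z c * r\<^sup>2 + v2 x y z c)\<^sup>2
      = ((k1 - k3) * e1 + (k2 - k1) * f1)\<^sup>2 + ((k1 - k3) * e2 + (k2 - k1) * f2)\<^sup>2"
    by algebra
  also have "\<dots> = (k1 - k3)\<^sup>2 * E + 2 * (k1 - k3) * (k2 - k1) * H + (k2 - k1)\<^sup>2 * G"
    unfolding gram by algebra
  finally have uv: "(u1 x y z c * r\<^sup>2 + v1 x y z c)\<^sup>2 + (u2 x y z c * r\<^sup>2 + v2 x y z c)\<^sup>2
      = (k1 - k3)\<^sup>2 * E + 2 * (k1 - k3) * (k2 - k1) * H + (k2 - k1)\<^sup>2 * G" .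

  have "((R\<^sup>2 - d\<^sup>2 - 3 * r\<^sup>2)\<^sup>2 - (2 * r * R)\<^sup>2) * (D * K)
      = K * (D * (P - 4 * r\<^sup>2)\<^sup>2 - r\<^sup>2 * (E * F * G)) + (P - 4 * r\<^sup>2) * (4 * r * h * D * K)"
    using d circumradius by algebra
  also have "\<dots> = r\<^sup>2 * ((k1 - k3)\<^sup>2 * E + 2 * (k1 - k3) * (k2 - k1) * H + (k2 - k1)\<^sup>2 * G)"
    using gram_barycentric_identity[of E G H b g "r\<^sup>2"]
    unfolding heights(2)
    unfolding K_def P_def k pmn gram(4,5) sum(1) .
  finally have "(R\<^sup>2 - d\<^sup>2 - 3 * r\<^sup>2)\<^sup>2 - (2 * r * R)\<^sup>2
      = r\<^sup>2 * (((u1 x y z c * r\<^sup>2 + v1 x y z c)\<^sup>2 + (u2 x y z c * r\<^sup>2 + v2 x y z c)\<^sup>2) / (D * K))"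
    using D_pos K_pos unfolding uv times_divide_eq_right by (simp add: eq_divide_eq)
  moreover have "a0 x y z * (coeff_A x y z c - coeff_B x y z c * r\<^sup>2) = D * K"
    unfolding a0 A B K_def D by algebra
  moreover have "coeff_A x y z c > 0" "coeff_B x y z c > 0"
    unfolding A B using S D_pos abg_pos P_pos by simp_all
  ultimately show ?thesis
    using S by (simp add: a0)
qed

end
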